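(* Let $S=\{(x,y)\in\mathbb{R}^2 : y^2=x^3-x^4\}$ and, for $\varepsilon>0$, let $\tilde S_\varepsilon=\{(x,y,z)\in\mathbb{R}^3 : (z/\varepsilon)^2+(x-\tfrac12)^2-\tfrac14=0,\ \varepsilon y-zx=0\}$. Let $\mu\in\mathbb{R}$ and let $u_0$ be an initial function on $S\setminus\{0\}$ as described in the context. Let $u$ be the solution of the reference problem $$\partial_t u=\Delta_S u-\mu^2 u,\qquad t\in(0,\infty),\ (x,y)\in S\setminus\{0\},$$ $$u(t,0_+)=u(t,0_-),\qquad \partial_{\mathbf T}u(t,0_+)=\partial_{\mathbf T}u(t,0_-),\qquad t\in(0,\infty),$$ $$u(0,x,y)=u_0(x,y),\qquad (x,y)\in S\setminus\{0\}.$$ For $\varepsilon>0$ let $v_\varepsilon$ be the solution of the regularized problem $$\partial_t v_\varepsilon=\Delta_{\tilde S_\varepsilon}v_\varepsilon-\mu^2 v_\varepsilon,\qquad t\in(0,\infty),\ (x,y,z)\in\tilde S_\varepsilon,$$ $$v_\varepsilon(0,x,y,z)=u_0(x,y),\qquad (x,y,z)\in\tilde S_\varepsilon,$$ and let $u_\varepsilon$ be its pull-down to $S\setminus\{0\}$, $$u_\varepsilon:(0,\infty)\times (S\setminus\{0\})\to\mathbb{R},\qquad u_\varepsilon(t,x,y):=v_\varepsilon\!\left(t,x,y,\varepsilon\tfrac{y}{x}\right).$$ Then, for any fixed time $t>0$, $u_\varepsilon(t,\cdot)$ converges uniformly (on $S\setminus\{0\}$) to $u(t,\cdot)$ as $\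varepsilon\to0$.
   Context: Surface differential operators. At a regular point $\mathbf{x}$ of a smooth embedded curve or surface $\Gamma\subset\mathbb{R}^n$ let $P(\mathbf{x})$ be the orthogonal projector onto the tangent space. For $C^1$ functions $u:\Gamma\to\mathbb{R}$ and $g:\Gamma\to\mathbb{R}^n$ with $C^1$ local extensions $u_E,g_E$ to $\mathbb{R}^n$, set $\nabla_\Gamma u(\mathbf{x})^T=\nabla u_E(\mathbf{x})^T P(\mathbf{x})$, $\operatorname{div}_\Gamma g(\mathbf{x})=\operatorname{trace}(Dg_E(\mathbf{x})P(\mathbf{x}))$, and, for $C^2$ functions, $\Delta_\Gamma u=\operatorname{div}_\Gamma(\nabla_\Gamma u)$. The origin is the only singular point of $S$; $\Delta_S$ is used on the smooth part $S\setminus\{0\}$. For $\varepsilon>0$ the curve $\tilde S_\varepsilon$ is a smooth closed curve, and $(x,y,z)\mapsto(x,y)$ is a bijection $\tilde S_\varepsilon\to S$ with inverse $(x,y)\mapsto(x,y,\varepsilon y/x)$ for $x\ne0$ and $(0,0)\mapsto(0,0,0)$. Boundary conditions. $\mathbf T$ is the counter-clockwise unit tangent field on $S\setminus\{0\}$ and $\partial_{\mathbf T}u=\mathbf T^T\nabla_S u$. If $\bar\gamma:(0,L)\to S\setminus\{0\}$ is a counter-clockwise arclength parametrization with $\bar\gamma(s)\to0$ as $s\to0$ and as $s\to L$, then $f(0_-)=\lim_{s\to0}f(\bar\gamma(s))$ and $f(0_+)=\lim_{s\to L}f(\bar\gamma(s))$. Parametrizations. $S\setminus\{0\}$ is parametrized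 by $\gamma:(-\pi,\pi)\to S\setminus\{0\}$, $\gamma(\theta)=(\tfrac12(1+\cos\theta),\tfrac14(1+\cos\theta)\sin\theta)$, and $\tilde S_\varepsilon$ by $\tilde\gamma_\varepsilon:[-\pi,\pi)\to\mathbb{R}^3$, $\tilde\gamma_\varepsilon(\theta)=(\tfrac12(1+\cos\theta),\tfrac14(1+\cos\theta)\sin\theta,\tfrac{\varepsilon}{2}\sin\theta)$. Let $a(\theta)=\int_{-\pi}^\theta|\gamma'(\tau)|\,d\tau$, $a_\varepsilon(\theta)=\int_{-\pi}^\theta|\tilde\gamma_\varepsilon'(\tau)|\,d\tau$, $L=a(\pi)$, $L_\varepsilon=a_\varepsilon(\pi)$. Initial function. $u_0:S\setminus\{0\}\to\mathbb{R}$ is such that $\hat u_0:=u_0\circ\gamma$ is integrable on $(-\pi,\pi)$ (so that the coefficients below are defined); its value at the origin, needed for the initial condition at the single point $(0,0,0)\in\tilde S_\varepsilon$, is arbitrary. Meaning of "the solution". The solutions of the two problems are those given by Fourier series in the arclength variable, i.e. $$u(t,\gamma(\theta))=e^{-\mu^2t}\sum_{m=-\infty}^\infty c_m e^{-(2\pi/L)^2m^2t}e^{i(2\pi/L)m\,a(\theta)},\quad c_m=\frac1L\int_{-\pi}^{\pi}\hat u_0(\theta)e^{-i(2\pi/L)m\,a(\theta)}a'(\theta)\,d\theta,$$ $$v_\varepsilon(t,\tilde\gamma_\varepsilon(\theta))=e^{-\mu^2t}\sum_{m=-\infty}^\infty c_{\varepsilon,m} e^{-(2\pi/L_\varepsilon)^2m^2t}e^{i(2\pi/L_\varepsilon)m\,a_\varepsilon(\theta)},\quad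 c_{\varepsilon,m}=\frac1{L_\varepsilon}\int_{-\pi}^{\pi}\hat u_0(\theta)e^{-i(2\pi/L_\varepsilon)m\,a_\varepsilon(\theta)}a_\varepsilon'(\theta)\,d\theta.$$ *)

theory Defs
  imports "HOL-Analysis.Analysis"
begin

section \<open>Surface differential operators\<close>

text \<open>
  \<open>\<Gamma>\<close> is a subset of a Euclidean space; the notions below are meant at its regular points, where
  \<open>\<Gamma>\<close> is an embedded curve or surface and the velocities of curves in \<open>\<Gamma>\<close> form a linear subspace.
\<close>

definition tangent_space :: "'a::euclidean_space set \<Rightarrow> 'a \<Rightarrow> 'a set" where
  "tangent_space \<Gamma> x =
     {w. \<exists>c. c 0 = x \<and> eventually (\<lambda>s. c s \<in> \<Gamma>) (nhds 0) \<and> (c has_vector_derivative w) (at (0::real))}"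

definition tangent_projector :: "'a::euclidean_space set \<Rightarrow> 'a \<Rightarrow> 'a \<Rightarrow> 'a" where
  "tangent_projector \<Gamma> x h =
     (THE w. w \<in> tangent_space \<Gamma> x \<and> (\<forall>\<tau>\<in>tangent_space \<Gamma> x. orthogonal (h - w) \<tau>))"

definition operator_trace :: "('a::euclidean_space \<Rightarrow> 'a) \<Rightarrow> real" where
  "operator_trace A = (\<Sum>b\<in>Basis. A b \<bullet> b)"

text \<open>
  The operators are given as relations, so that differentiability is part of the claim that they take
  a given value. Here \<open>f\<^sub>E\<close>, \<open>g\<^sub>E\<close> are \<open>C\<^sup>1\<close> extensions to an open neighbourhood \<open>U\<close> of \<open>x\<close>; the value
  does not depend on their choice, as only derivatives in tangential directions enter.
\<close>

definition has_surface_gradient ::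
  "'a::euclidean_space set \<Rightarrow> ('a \<Rightarrow> real) \<Rightarrow> 'a \<Rightarrow> 'a \<Rightarrow> bool" where
  "has_surface_gradient \<Gamma> f x w \<longleftrightarrow>
     (\<exists>U f\<^sub>E D. open U \<and> x \<in> U \<and> (\<forall>y\<in>\<Gamma> \<inter> U. f\<^sub>E y = f y) \<and>
        (\<forall>y\<in>U. GDERIV f\<^sub>E y :> D y) \<and> continuous_on U D \<and>
        (\<forall>h. w \<bullet> h = D x \<bullet> tangent_projector \<Gamma> x h))"

definition has_surface_divergence ::
  "'a::euclidean_space set \<Rightarrow> ('a \<Rightarrow> 'a) \<Rightarrow> 'a \<Rightarrow> real \<Rightarrow> bool" where
  "has_surface_divergence \<Gamma> g x d \<longleftrightarrow>
     (\<exists>U g\<^sub>E (D :: 'a \<Rightarrow> 'a \<Rightarrow>\<^sub>L 'a). open U \<and> x \<in> U \<and> (\<forall>y\<in>\<Gamma> \<inter> U. g\<^sub>E y = g y) \<and>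
        (\<forall>y\<in>U. (g\<^sub>E has_derivative blinfun_apply (D y)) (at y)) \<and> continuous_on U D \<and>
        d = operator_trace (\<lambda>h. blinfun_apply (D x) (tangent_projector \<Gamma> x h)))"

definition has_surface_laplacian ::
  "'a::euclidean_space set \<Rightarrow> ('a \<Rightarrow> real) \<Rightarrow> 'a \<Rightarrow> real \<Rightarrow> bool" where
  "has_surface_laplacian \<Gamma> f x d \<longleftrightarrow>
     (\<exists>G. (\<forall>y\<in>\<Gamma>. has_surface_gradient \<Gamma> f y (G y)) \<and> has_surface_divergence \<Gamma> G x d)"

definition satisfies_surface_pde ::
  "'a::euclidean_space set \<Rightarrow> real \<Rightarrow> (real \<Rightarrow> 'a \<Rightarrow> real) \<Rightarrow> bool" where
  "satisfies_surface_pde \<Gamma> \<mu> u \<longleftrightarrow>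
     (\<forall>t>0. \<forall>x\<in>\<Gamma>. \<exists>d. has_surface_laplacian \<Gamma> (u t) x d \<and>
        ((\<lambda>s. u s x) has_real_derivative (d - \<mu>\<^sup>2 * u t x)) (at t))"


section \<open>The singular curve and its regularization\<close>

definition curve_S :: "(real \<times> real) set" where
  "curve_S = {(x, y). y\<^sup>2 = x^3 - x^4}"

definition curve_S_eps :: "real \<Rightarrow> (real \<times> real \<times> real) set" where
  "curve_S_eps \<epsilon> = {(x, y, z). (z / \<epsilon>)\<^sup>2 + (x - 1/2)\<^sup>2 - 1/4 = 0 \<and> \<epsilon> * y - z * x = 0}"

definition gam :: "real \<Rightarrow> real \<times> real" where
  "gam \<theta> = (1/2 * (1 + cos \<theta>), 1/4 * (1 + cos \<theta>) * sin \<theta>)"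

definition gam_eps :: "real \<Rightarrow> real \<Rightarrow> real \<times> real \<times> real" where
  "gam_eps \<epsilon> \<theta> = (1/2 * (1 + cos \<theta>), 1/4 * (1 + cos \<theta>) * sin \<theta>, \<epsilon>/2 * sin \<theta>)"

definition arclength :: "(real \<Rightarrow> 'a::euclidean_space) \<Rightarrow> real \<Rightarrow> real" where
  "arclength c \<theta> = integral {-pi..\<theta>} (\<lambda>\<tau>. norm (vector_derivative c (at \<tau>)))"

text \<open>\<open>gam\<close> runs counter-clockwise through \<open>curve_S - {(0, 0)}\<close> as its argument increases from \<open>-pi\<close> to \<open>pi\<close>.\<close>

definition gam_arc :: "real \<Rightarrow> real \<times> real" where
  "gam_arc s = gam (the_inv_into {-pi<..<pi} (arclength gam) s)"

definition unit_tangent :: "real \<times> real \<Rightarrow> real \<times> real" where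
  "unit_tangent p = sgn (vector_derivative gam (at (the_inv_into {-pi<..<pi} gam p)))"

text \<open>\<open>f(0\<^sub>-) = f(0\<^sub>+)\<close>, where both one-sided limits are required to exist.\<close>

definition matches_at_origin :: "(real \<times> real \<Rightarrow> real) \<Rightarrow> bool" where
  "matches_at_origin f \<longleftrightarrow>
     (\<exists>l. ((\<lambda>s. f (gam_arc s)) \<longlongrightarrow> l) (at_right 0) \<and>
          ((\<lambda>s. f (gam_arc s)) \<longlongrightarrow> l) (at_left (arclength gam pi)))"


section \<open>The two problems and their solutions\<close>

definition solves_reference_problem ::
  "real \<Rightarrow> (real \<times> real \<Rightarrow> real) \<Rightarrow> (real \<Rightarrow> real \<times> real \<Rightarrow> real) \<Rightarrow> bool" where
  "solves_reference_problem \<mu> u\<^sub>0 u \<longleftrightarrow>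
     satisfies_surface_pde (curve_S - {(0, 0)}) \<mu> u \<and>
     (\<forall>t>0. matches_at_origin (u t)) \<and>
     (\<forall>t>0. \<exists>G. (\<forall>p\<in>curve_S - {(0, 0)}. has_surface_gradient (curve_S - {(0, 0)}) (u t) p (G p)) \<and>
        matches_at_origin (\<lambda>p. unit_tangent p \<bullet> G p)) \<and>
     (\<forall>p\<in>curve_S - {(0, 0)}. u 0 p = u\<^sub>0 p)"

definition solves_regularized_problem ::
  "real \<Rightarrow> real \<Rightarrow> (real \<times> real \<Rightarrow> real) \<Rightarrow> (real \<Rightarrow> real \<times> real \<times> real \<Rightarrow> real) \<Rightarrow> bool" where
  "solves_regularized_problem \<epsilon> \<mu> u\<^sub>0 v \<longleftrightarrow>
     satisfies_surface_pde (curve_S_eps \<epsilon>) \<mu> v \<and>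
     (\<forall>x y z. (x, y, z) \<in> curve_S_eps \<epsilon> \<longrightarrow> v 0 (x, y, z) = u\<^sub>0 (x, y))"

text \<open>
  For a closed curve \<open>c\<close> parametrized over \<open>(-pi, pi)\<close> and an initial function \<open>w\<close> of the parameter:
  the Fourier coefficients and the Fourier series solution in the arclength variable.
\<close>

definition fourier_coeff :: "(real \<Rightarrow> 'a::euclidean_space) \<Rightarrow> (real \<Rightarrow> real) \<Rightarrow> int \<Rightarrow> complex" where
  "fourier_coeff c w m =
     1 / of_real (arclength c pi) *
     (LINT \<theta>:{-pi<..<pi}|lebesgue.
        of_real (w \<theta>) * exp (- \<i> * of_real (2 * pi / arclength c pi * of_int m * arclength c \<theta>)) *
        of_real (deriv (arclength c) \<theta>))"

definition fourier_solution ::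
  "(real \<Rightarrow> 'a::euclidean_space) \<Rightarrow> real \<Rightarrow> (real \<Rightarrow> real) \<Rightarrow> real \<Rightarrow> real \<Rightarrow> complex" where
  "fourier_solution c \<mu> w t \<theta> =
     of_real (exp (- \<mu>\<^sup>2 * t)) *
     (\<Sum>\<^sub>\<infinity>m\<in>UNIV.
        fourier_coeff c w m * of_real (exp (- (2 * pi / arclength c pi)\<^sup>2 * (of_int m)\<^sup>2 * t)) *
        exp (\<i> * of_real (2 * pi / arclength c pi * of_int m * arclength c \<theta>)))"

text \<open>
  ``The solution'' of either problem is the one given by the Fourier series for positive times. For
  merely integrable initial data the series need not converge at time \<open>0\<close>, where the initial
  condition prescribes the values.
\<close>

definition is_reference_solution ::
  "real \<Rightarrow> (real \<times> real \<Rightarrow> real) \<Rightarrow> (real \<Rightarrow> real \<times> real \<Rightarrow> real) \<Rightarrow> bool" where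
  "is_reference_solution \<mu> u\<^sub>0 u \<longleftrightarrow>
     solves_reference_problem \<mu> u\<^sub>0 u \<and>
     (\<forall>t>0. \<forall>\<theta>\<in>{-pi<..<pi}. of_real (u t (gam \<theta>)) = fourier_solution gam \<mu> (u\<^sub>0 \<circ> gam) t \<theta>)"

definition is_regularized_solution ::
  "real \<Rightarrow> real \<Rightarrow> (real \<times> real \<Rightarrow> real) \<Rightarrow> (real \<Rightarrow> real \<times> real \<times> real \<Rightarrow> real) \<Rightarrow> bool" where
  "is_regularized_solution \<epsilon> \<mu> u\<^sub>0 v \<longleftrightarrow>
     solves_regularized_problem \<epsilon> \<mu> u\<^sub>0 v \<and>
     (\<forall>t>0. \<forall>\<theta>\<in>{-pi..<pi}. of_real (v t (gam_eps \<epsilon> \<theta>)) = fourier_solution (gam_eps \<epsilon>) \<mu> (u\<^sub>0 \<circ> gam) t \<theta>)"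

definition pull_down ::
  "real \<Rightarrow> (real \<Rightarrow> real \<times> real \<times> real \<Rightarrow> real) \<Rightarrow> real \<Rightarrow> real \<times> real \<Rightarrow> real" where
  "pull_down \<epsilon> v t = (\<lambda>(x, y). v t (x, y, \<epsilon> * (y / x)))"

end

(*
  Along a closed curve the Fourier series solution depends only on the speed of the parametrization.
  The speeds of the regularized curves converge uniformly to the speed of the singular one (they differ
  by at most eps/2), hence so do the arclength functions, and every term of the Fourier series converges
  uniformly in the parameter. For t > 0 the terms are dominated by a Gaussian in the frequency m,
  uniformly in eps: the coefficients are bounded by the L1 norm of the initial function, and the total
  lengths stay close to the limit length. A uniform version of Tannery's theorem gives the claim.
*)
theory Submission
  imports Defs
begin

section \<open>Uniform limits and dominated series\<close>

text \<open>A chord of the unit circle is no longer than its arc, so \<open>cis\<close> is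
  1-Lipschitz.\<close>

lemma uniformly_continuous_on_cis: "uniformly_continuous_on UNIV cis"
  unfolding uniformly_continuous_on_def
proof (intro allI impI)
  fix e :: real assume "e > 0"
  have "dist (cis x) (cis y) \<le> dist x y" for x y
  proof -
    have "cis x - cis y = cis y * (cis (x - y) - 1)"
      by (simp add: algebra_simps cis_mult)
    then have "norm (cis x - cis y) = 2 * \<bar>sin ((x - y) / 2)\<bar>"
      using dist_exp_i_1[of "x - y"] by (simp only: norm_mult cis_conv_exp) simp
    also have "\<dots> \<le> \<bar>x - y\<bar>"
      using abs_sin_x_le_abs_x[of "(x - y) / 2"] by simp
    finally show ?thesis by (simp add: dist_norm)
  qed
  with \<open>e > 0\<close> show "\<exists>d>0. \<forall>x\<in>UNIV. \<forall>x'\<in>UNIV. dist x' x < d \<longrightarrow> dist (cis x') (cis x) < e"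
    by (meson order_le_less_trans)
qed

lemma uniform_limit_cis:
  assumes "uniform_limit X f l F"
  shows "uniform_limit X (\<lambda>i x. cis (f i x)) (\<lambda>x. cis (l x)) F"
  using uniform_limit_compose[OF assms uniformly_continuous_on_cis] by (simp add: o_def)

text \<open>Brings factors that do not depend on the curve parameter, such as coefficients and
  lengths, into the uniform product rule.\<close>

lemma tendsto_imp_uniform_limit:
  assumes "(f \<longlongrightarrow> l) F"
  shows "uniform_limit X (\<lambda>i x. f i) (\<lambda>x. l) F"
  using assms by (auto simp: uniform_limit_iff tendsto_iff elim: eventually_mono)

text \<open>A finite index set \<open>Y\<close> carries the sum of \<open>M\<close> up to
  \<open>e / 3\<close>. On \<open>Y\<close> finitely many uniform limits are combined; outside
  \<open>Y\<close> both tails are bounded by the tail of \<open>M\<close>, for all \<open>x\<close>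
  at once.\<close>

lemma uniform_limit_infsum_dominated:
  fixes f :: "'i \<Rightarrow> 'm \<Rightarrow> 'x \<Rightarrow> 'b::banach"
  assumes lim: "\<And>m. uniform_limit X (\<lambda>i. f i m) (g m) F"
    and bound: "eventually (\<lambda>i. \<forall>m. \<forall>x\<in>X. norm (f i m x) \<le> M m) F"
    and M: "M summable_on UNIV"
  shows "uniform_limit X (\<lambda>i x. \<Sum>\<^sub>\<infinity>m. f i m x) (\<lambda>x. \<Sum>\<^sub>\<infinity>m. g m x) F"
proof (cases "F = bot")
  case F: False
  \<comment> \<open>The limits inherit the dominating bound. Passing to the limit in an inequality
    needs a nontrivial filter, hence the case distinction.\<close>
  have gM: "norm (g m x) \<le> M m" if "x \<in> X" for m x
  proof (rule tendsto_upperbound[OF _ _ F])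
    show "((\<lambda>i. norm (f i m x)) \<longlongrightarrow> norm (g m x)) F"
      using tendsto_uniform_limitI[OF lim that] by (rule tendsto_norm)
    show "eventually (\<lambda>i. norm (f i m x) \<le> M m) F"
      using bound that by (auto elim: eventually_mono)
  qed
  \<comment> \<open>Stated for any \<open>h\<close> and \<open>A\<close> because it serves both
    \<open>f i\<close> and \<open>g\<close>, on the whole index set and on the complement of
    \<open>Y\<close>.\<close>
  have sum: "h summable_on A" "norm (infsum h A) \<le> infsum M A"
    if "\<And>m. norm (h m) \<le> M m" for h :: "'m \<Rightarrow> 'b" and A
  proof -
    have MA: "M summable_on A" using M by (rule summable_on_subset_banach) auto
    have "(\<lambda>m. norm (h m)) summable_on A"
      by (rule Infinite_Sum.abs_summable_on_comparison_test'[OF MA]) (use that in auto)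
    then show "h summable_on A" by (rule abs_summable_summable)
    show "norm (infsum h A) \<le> infsum M A"
      by (rule norm_infsum_le[OF has_sum_infsum has_sum_infsum])
        (use that MA \<open>h summable_on A\<close> in auto)
  qed
  show ?thesis
  proof (rule uniform_limitI)
    fix e :: real assume e: "e > 0"
    have "(sum M \<longlongrightarrow> infsum M UNIV) (finite_subsets_at_top UNIV)"
      using M infsum_tendsto by blast
    then have "eventually (\<lambda>Y. dist (sum M Y) (infsum M UNIV) < e / 3) (finite_subsets_at_top UNIV)"
      using e by (intro tendstoD) auto
    then obtain Y where Y: "finite Y" "dist (sum M Y) (infsum M UNIV) < e / 3"
      by (auto simp: eventually_finite_subsets_at_top)
    have split: "infsum h UNIV = sum h Y + infsum h (- Y)" if "h summable_on UNIV"
      for h :: "'m \<Rightarrow> 'c::banach"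
      using infsum_Un_disjoint[of h Y "- Y"] that Y(1) summable_on_subset_banach[OF that]
      by (simp add: Compl_partition)
    have tail: "infsum M (- Y) < e / 3"
      using split[OF M] Y(2) by (simp add: dist_real_def)
    \<comment> \<open>The \<open>+ 1\<close> covers an empty \<open>Y\<close> and makes the total
      error on \<open>Y\<close> strictly less than \<open>e / 3\<close>.\<close>
    define d where "d = e / (3 * (card Y + 1))"
    have d: "d > 0" using e by (simp add: d_def)
    have "eventually (\<lambda>i. \<forall>m\<in>Y. \<forall>x\<in>X. dist (f i m x) (g m x) < d) F"
      using Y(1) lim d by (simp add: eventually_ball_finite uniform_limit_iff)
    then show "eventually (\<lambda>i. \<forall>x\<in>X. dist (\<Sum>\<^sub>\<infinity>m. f i m x) (\<Sum>\<^sub>\<infinity>m. g m x) < e) F"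
      using bound
    proof eventually_elim
      case (elim i)
      show ?case
      proof
        fix x assume x: "x \<in> X"
        have f: "\<And>m. norm (f i m x) \<le> M m" using elim x by auto
        have "norm (sum (\<lambda>m. f i m x - g m x) Y) \<le> of_nat (card Y) * d"
          by (rule sum_norm_bound) (use elim x in \<open>auto simp: dist_norm intro: less_imp_le\<close>)
        also have "\<dots> < e / 3"
          using e by (simp add: d_def field_simps)
        finally have 1: "norm (sum (\<lambda>m. f i m x - g m x) Y) < e / 3" .
        have "(\<Sum>\<^sub>\<infinity>m. f i m x) - (\<Sum>\<^sub>\<infinity>m. g m x)
            = sum (\<lambda>m. f i m x - g m x) Y + infsum (\<lambda>m. f i m x) (- Y) - infsum (\<lambda>m. g m x) (- Y)"
          by (simp add: split sum(1) f gM x sum_subtractf)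
        also have "norm \<dots> \<le> norm (sum (\<lambda>m. f i m x - g m x) Y)
            + norm (infsum (\<lambda>m. f i m x) (- Y)) + norm (infsum (\<lambda>m. g m x) (- Y))"
          by (smt (verit) norm_triangle_ineq norm_triangle_ineq4)
        also have "\<dots> < e"
          using 1 tail sum(2)[of "\<lambda>m. f i m x" "- Y", OF f]
            sum(2)[of "\<lambda>m. g m x" "- Y", OF gM[OF x]] by linarith
        finally show "dist (\<Sum>\<^sub>\<infinity>m. f i m x) (\<Sum>\<^sub>\<infinity>m. g m x) < e" by (simp add: dist_norm)
      qed
    qed
  qed
qed (auto simp: uniform_limit_iff)

text \<open>Since n \<le> n^2 for natural n, the terms with m \<ge> 0 lie below a geometric series;
  those with m \<le> 0 mirror them.\<close>

lemma summable_on_int_gaussian: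
  fixes k :: real
  assumes "k > 0"
  shows "(\<lambda>m::int. exp (- k * (of_int m)\<^sup>2)) summable_on UNIV"
proof -
  have nat: "(\<lambda>n::nat. exp (- k * (real n)\<^sup>2)) summable_on UNIV"
  proof (rule norm_summable_imp_summable_on, rule summable_comparison_test)
    have "exp (- k * (real n)\<^sup>2) \<le> exp (- k) ^ n" for n
    proof -
      have "real n \<le> (real n)\<^sup>2"
        by (cases n) (auto simp: power2_eq_square)
      then show ?thesis
        using assms by (simp add: exp_of_nat_mult[symmetric] mult.commute)
    qed
    then show "\<exists>N. \<forall>n\<ge>N. norm (norm (exp (- k * (real n)\<^sup>2))) \<le> exp (- k) ^ n"
      by simp
    show "summable (\<lambda>n. exp (- k) ^ n)"
      using assms by (intro summable_geometric) auto
  qed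
  \<comment> \<open>The two ranges share 0, which is harmless as only summability is
    claimed.\<close>
  have "(\<lambda>m::int. exp (- k * (of_int m)\<^sup>2)) summable_on (range int \<union> range (\<lambda>n. - int n))"
    by (intro summable_on_union)
      (subst summable_on_reindex; use nat in \<open>simp add: o_def inj_def\<close>)+
  moreover have "range int \<union> range (\<lambda>n. - int n) = UNIV"
    by (auto simp: image_iff) (metis int_cases2)
  ultimately show ?thesis by simp
qed

section \<open>Integrals against an integrable weight\<close>

text \<open>Continuity on the closed interval makes \<open>g\<close> bounded and measurable, and a
  bounded measurable factor preserves absolute integrability.\<close>

lemma absolutely_integrable_mult_continuous:
  fixes w :: "real \<Rightarrow> real" and g :: "real \<Rightarrow> complex"
  assumes "w absolutely_integrable_on {a<..<b}" "continuous_on {a..b} g"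
  shows "(\<lambda>x. of_real (w x) * g x) absolutely_integrable_on {a<..<b}"
proof -
  have "(\<lambda>x. (\<lambda>z r. r *\<^sub>R z) (g x) (w x)) absolutely_integrable_on {a<..<b}"
  proof (rule absolutely_integrable_bounded_measurable_product[where h = "\<lambda>z r. r *\<^sub>R z", OF _ _ _ _ assms(1)])
    show "bilinear (\<lambda>(z::complex) r. r *\<^sub>R z)"
      by (auto simp: bilinear_def linear_iff algebra_simps)
    have "continuous_on {a<..<b} g"
      using assms(2) by (rule continuous_on_subset) auto
    then show "g \<in> borel_measurable (lebesgue_on {a<..<b})"
      by (rule continuous_imp_measurable_on_sets_lebesgue) auto
    show "bounded (g ` {a<..<b})"
      by (rule bounded_subset[OF compact_imp_bounded[OF compact_continuous_image[OF assms(2)]]]) auto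
  qed auto
  then show ?thesis by (simp add: scaleR_conv_of_real)
qed

text \<open>The difference of the integrals is at most the supremum of |g i - h| times the L1 norm
  of \<open>w\<close>. This direct estimate works along any filter.\<close>

lemma tendsto_weighted_LINT:
  fixes w :: "real \<Rightarrow> real" and g :: "'i \<Rightarrow> real \<Rightarrow> complex"
  assumes w: "w absolutely_integrable_on {a<..<b}"
    and lim: "uniform_limit {a..b} g h F"
    and g: "eventually (\<lambda>i. continuous_on {a..b} (g i)) F" and h: "continuous_on {a..b} h"
  shows "((\<lambda>i. LINT x:{a<..<b}|lebesgue. of_real (w x) * g i x)
    \<longlongrightarrow> (LINT x:{a<..<b}|lebesgue. of_real (w x) * h x)) F"
proof (rule tendstoI)
  fix e :: real assume e: "e > 0"
  define W where "W = (LINT x:{a<..<b}|lebesgue. norm (w x))"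
  have W: "W \<ge> 0"
    unfolding W_def set_lebesgue_integral_def by (rule Bochner_Integration.integral_nonneg) auto
  have wn: "(\<lambda>x. norm (w x)) absolutely_integrable_on {a<..<b}"
    using w by (rule absolutely_integrable_norm[unfolded o_def])
  \<comment> \<open>\<open>W + 1\<close> instead of \<open>W\<close> avoids division by zero for a
    vanishing weight and keeps the final inequality strict.\<close>
  have "eventually (\<lambda>i. \<forall>x\<in>{a..b}. dist (g i x) (h x) < e / (W + 1)) F"
    using lim e W by (auto simp: uniform_limit_iff)
  then show "eventually (\<lambda>i. dist (LINT x:{a<..<b}|lebesgue. of_real (w x) * g i x)
      (LINT x:{a<..<b}|lebesgue. of_real (w x) * h x) < e) F"
    using g
  proof eventually_elim
    case (elim i)
    have gi: "(\<lambda>x. of_real (w x) * g i x) absolutely_integrable_on {a<..<b}"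
      and hi: "(\<lambda>x. of_real (w x) * h x) absolutely_integrable_on {a<..<b}"
      using elim w h by (auto intro: absolutely_integrable_mult_continuous)
    have di: "(\<lambda>x. of_real (w x) * (g i x - h x)) absolutely_integrable_on {a<..<b}"
      using elim by (intro absolutely_integrable_mult_continuous[OF w] continuous_on_diff h)
    have "norm ((LINT x:{a<..<b}|lebesgue. of_real (w x) * g i x)
        - (LINT x:{a<..<b}|lebesgue. of_real (w x) * h x))
        = norm (LINT x:{a<..<b}|lebesgue. of_real (w x) * (g i x - h x))"
      by (simp only: set_integral_diff(2)[OF gi hi, symmetric] right_diff_distrib)
    also have "\<dots> \<le> (LINT x:{a<..<b}|lebesgue. norm (of_real (w x) * (g i x - h x)))"
      using di by (rule set_integral_norm_bound)
    also have "\<dots> \<le> (LINT x:{a<..<b}|lebesgue. norm (w x) * (e / (W + 1)))"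
    proof (rule set_integral_mono)
      show "set_integrable lebesgue {a<..<b} (\<lambda>x. norm (of_real (w x) * (g i x - h x)))"
        using di by (rule absolutely_integrable_norm[unfolded o_def])
      show "set_integrable lebesgue {a<..<b} (\<lambda>x. norm (w x) * (e / (W + 1)))"
        using wn by simp
      show "norm (of_real (w x) * (g i x - h x)) \<le> norm (w x) * (e / (W + 1))"
        if "x \<in> {a<..<b}" for x
        unfolding norm_mult norm_of_real real_norm_def
        by (rule mult_left_mono) (use elim(1) that in \<open>auto simp: dist_norm less_imp_le\<close>)
    qed
    also have "\<dots> = W * (e / (W + 1))"
      by (simp add: W_def)
    also have "\<dots> < e" using W e by (simp add: field_simps)
    finally show ?case by (simp add: dist_norm)
  qed
qed

section \<open>Speed and arclength\<close>

text \<open>The integrand of \<open>arclength\<close>, named because the Fourier solution sees a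
  curve only through it.\<close>

definition speed :: "(real \<Rightarrow> 'a::euclidean_space) \<Rightarrow> real \<Rightarrow> real" where
  "speed c \<tau> = norm (vector_derivative c (at \<tau>))"

lemma speed_nonneg: "speed c \<tau> \<ge> 0"
  by (simp add: speed_def)

lemma arclength_eq_integral_speed: "arclength c \<theta> = integral {-pi..\<theta>} (speed c)"
  by (simp add: arclength_def speed_def[abs_def])

lemma continuous_on_arclength:
  assumes "continuous_on {-pi..pi} (speed c)"
  shows "continuous_on {-pi..pi} (arclength c)"
  unfolding arclength_eq_integral_speed[abs_def]
  by (intro indefinite_integral_continuous_1 integrable_continuous_real assms)

text \<open>The fundamental theorem of calculus gives a derivative within the closed interval; it is
  two-sided at interior points, whence the open range of \<theta>.\<close>

lemma deriv_arclength:
  assumes "continuous_on {-pi..pi} (speed c)" "\<theta> \<in> {-pi<..<pi}"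
  shows "deriv (arclength c) \<theta> = speed c \<theta>"
proof (rule DERIV_imp_deriv)
  have "(arclength c has_real_derivative speed c \<theta>) (at \<theta> within {-pi..pi})"
    unfolding arclength_eq_integral_speed[abs_def]
    by (rule integral_has_real_derivative) (use assms in auto)
  moreover have "\<theta> \<in> interior {-pi..pi}"
    using assms(2) by simp
  ultimately show "(arclength c has_real_derivative speed c \<theta>) (at \<theta>)"
    by (metis at_within_interior)
qed

text \<open>Integrating a uniform error \<open>d\<close> of the speeds over a range of length at
  most 2 pi gives an error of at most 2 pi d. The curves have separate types, as the limit curve
  lies in the plane and the others in space.\<close>

lemma uniform_limit_arclength:
  fixes c :: "'i \<Rightarrow> real \<Rightarrow> 'a::euclidean_space" and c0 :: "real \<Rightarrow> 'b::euclidean_space"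
  assumes c: "eventually (\<lambda>i. continuous_on {-pi..pi} (speed (c i))) F"
    and c0: "continuous_on {-pi..pi} (speed c0)"
    and lim: "uniform_limit {-pi..pi} (\<lambda>i. speed (c i)) (speed c0) F"
  shows "uniform_limit {-pi..pi} (\<lambda>i. arclength (c i)) (arclength c0) F"
proof (rule uniform_limitI)
  fix e :: real assume e: "e > 0"
  define d where "d = e / (2 * pi + 1)"
  have "2 * pi + 1 > 0" using pi_gt_zero by linarith
  with e have d: "d > 0" and "2 * pi * d < e"
    unfolding d_def by (auto simp: field_simps)
  have "eventually (\<lambda>i. \<forall>\<tau>\<in>{-pi..pi}. dist (speed (c i) \<tau>) (speed c0 \<tau>) < d) F"
    using lim d by (simp add: uniform_limit_iff)
  then show "eventually (\<lambda>i. \<forall>\<theta>\<in>{-pi..pi}. dist (arclength (c i) \<theta>) (arclength c0 \<theta>) < e) F"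
    using c
  proof eventually_elim
    case (elim i)
    show ?case
    proof
      fix \<theta> assume \<theta>: "\<theta> \<in> {-pi..pi}"
      then have sub: "{-pi..\<theta>} \<subseteq> {-pi..pi}" by auto
      have int: "speed (c i) integrable_on {-pi..\<theta>}" "speed c0 integrable_on {-pi..\<theta>}"
        using elim(2) c0 sub by (auto intro!: integrable_continuous_real intro: continuous_on_subset)
      have "norm (arclength (c i) \<theta> - arclength c0 \<theta>)
          = norm (integral (cbox (-pi) \<theta>) (\<lambda>\<tau>. speed (c i) \<tau> - speed c0 \<tau>))"
        using int by (simp add: arclength_eq_integral_speed Henstock_Kurzweil_Integration.integral_diff)
      also have "\<dots> \<le> d * measure lborel (cbox (-pi) \<theta>)"
        by (rule has_integral_bound[where f = "\<lambda>\<tau>. speed (c i) \<tau> - speed c0 \<tau>"])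
          (use int d elim(1) \<theta> in
            \<open>auto simp: dist_norm intro!: integrable_integral integrable_diff less_imp_le\<close>)
      also have "\<dots> \<le> d * (2 * pi)"
        using \<theta> d by (intro mult_left_mono) auto
      also have "\<dots> < e" using \<open>2 * pi * d < e\<close> by (simp add: mult.commute)
      finally show "dist (arclength (c i) \<theta>) (arclength c0 \<theta>) < e" by (simp add: dist_norm)
    qed
  qed
qed

section \<open>Phases and Fourier coefficients\<close>

text \<open>The real argument of the m-th Fourier mode: the mode is \<open>cis\<close> of it and has
  modulus one.\<close>

definition phase :: "(real \<Rightarrow> 'a::euclidean_space) \<Rightarrow> int \<Rightarrow> real \<Rightarrow> real" where
  "phase c m \<theta> = 2 * pi / arclength c pi * of_int m * arclength c \<theta>"

text \<open>Groups mode and speed into one kernel that is continuous up to the end points, the form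
  required by the lemmas on weighted integrals.\<close>

lemma fourier_coeff_eq:
  assumes "continuous_on {-pi..pi} (speed c)"
  shows "fourier_coeff c w m = of_real (1 / arclength c pi) *
    (LINT \<theta>:{-pi<..<pi}|lebesgue.
       of_real (w \<theta>) * (cis (- phase c m \<theta>) * of_real (speed c \<theta>)))"
proof -
  have "(LINT \<theta>:{-pi<..<pi}|lebesgue.
        of_real (w \<theta>) * exp (- \<i> * of_real (2 * pi / arclength c pi * of_int m * arclength c \<theta>)) *
        of_real (deriv (arclength c) \<theta>))
    = (LINT \<theta>:{-pi<..<pi}|lebesgue.
       of_real (w \<theta>) * (cis (- phase c m \<theta>) * of_real (speed c \<theta>)))"
    by (rule set_lebesgue_integral_cong)
      (use assms in \<open>auto simp: deriv_arclength phase_def cis_conv_exp\<close>)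
  then show ?thesis by (simp only: fourier_coeff_def of_real_divide of_real_1)
qed

lemma fourier_solution_eq:
  "fourier_solution c \<mu> w t \<theta> = of_real (exp (- \<mu>\<^sup>2 * t)) *
     (\<Sum>\<^sub>\<infinity>m. fourier_coeff c w m *
        of_real (exp (- (2 * pi / arclength c pi)\<^sup>2 * (of_int m)\<^sup>2 * t)) * cis (phase c m \<theta>))"
  by (simp only: fourier_solution_def phase_def cis_conv_exp)

text \<open>Product rule for uniform limits: the frequency factors converge because the limit length
  is nonzero, and the limit arclength is bounded, being continuous on a compact interval.\<close>

lemma uniform_limit_phase:
  fixes c :: "'i \<Rightarrow> real \<Rightarrow> 'a::euclidean_space" and c0 :: "real \<Rightarrow> 'b::euclidean_space"
  assumes c: "eventually (\<lambda>i. continuous_on {-pi..pi} (speed (c i))) F"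
    and c0: "continuous_on {-pi..pi} (speed c0)"
    and lim: "uniform_limit {-pi..pi} (\<lambda>i. speed (c i)) (speed c0) F"
    and pos: "arclength c0 pi > 0"
  shows "uniform_limit {-pi..pi} (\<lambda>i. phase (c i) m) (phase c0 m) F"
proof -
  note A = uniform_limit_arclength[OF c c0 lim]
  have L: "((\<lambda>i. arclength (c i) pi) \<longlongrightarrow> arclength c0 pi) F"
    by (rule tendsto_uniform_limitI[OF A]) auto
  have "((\<lambda>i. 2 * pi / arclength (c i) pi * of_int m) \<longlongrightarrow> 2 * pi / arclength c0 pi * of_int m) F"
    using pos by (intro tendsto_intros L) auto
  note K = tendsto_imp_uniform_limit[OF this]
  have "bounded (arclength c0 ` {-pi..pi})"
    by (intro compact_imp_bounded compact_continuous_image continuous_on_arclength c0 compact_Icc)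
  then have "uniform_limit {-pi..pi}
      (\<lambda>i \<theta>. 2 * pi / arclength (c i) pi * of_int m * arclength (c i) \<theta>)
      (\<lambda>\<theta>. 2 * pi / arclength c0 pi * of_int m * arclength c0 \<theta>) F"
    by (intro uniform_lim_mult[OF K A]) (auto simp: image_constant_conv)
  then show ?thesis by (simp add: phase_def[abs_def])
qed

lemma continuous_on_fourier_kernel:
  assumes "continuous_on {-pi..pi} (speed c)"
  shows "continuous_on {-pi..pi} (\<lambda>\<theta>. cis (- phase c m \<theta>) * of_real (speed c \<theta>))"
  unfolding phase_def by (intro continuous_intros continuous_on_arclength assms)

lemma tendsto_fourier_coeff:
  fixes c :: "'i \<Rightarrow> real \<Rightarrow> 'a::euclidean_space" and c0 :: "real \<Rightarrow> 'b::euclidean_space"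
  assumes c: "eventually (\<lambda>i. continuous_on {-pi..pi} (speed (c i))) F"
    and c0: "continuous_on {-pi..pi} (speed c0)"
    and lim: "uniform_limit {-pi..pi} (\<lambda>i. speed (c i)) (speed c0) F"
    and pos: "arclength c0 pi > 0"
    and w: "w absolutely_integrable_on {-pi<..<pi}"
  shows "((\<lambda>i. fourier_coeff (c i) w m) \<longlongrightarrow> fourier_coeff c0 w m) F"
proof -
  have L: "((\<lambda>i. arclength (c i) pi) \<longlongrightarrow> arclength c0 pi) F"
    by (rule tendsto_uniform_limitI[OF uniform_limit_arclength[OF c c0 lim]]) auto
  have "bounded (speed c0 ` {-pi..pi})"
    by (intro compact_imp_bounded compact_continuous_image c0 compact_Icc)
  then have "bounded ((\<lambda>\<theta>. complex_of_real (speed c0 \<theta>)) ` {-pi..pi})"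
    by (simp add: bounded_iff)
  moreover have "bounded ((\<lambda>\<theta>. cis (- phase c0 m \<theta>)) ` {-pi..pi})"
    by (auto simp: bounded_iff)
  ultimately have kernel: "uniform_limit {-pi..pi}
      (\<lambda>i \<theta>. cis (- phase (c i) m \<theta>) * complex_of_real (speed (c i) \<theta>))
      (\<lambda>\<theta>. cis (- phase c0 m \<theta>) * complex_of_real (speed c0 \<theta>)) F"
    by (intro uniform_lim_mult uniform_limit_cis uniform_limit_uminus
        uniform_limit_phase[OF c c0 lim pos] bounded_linear.uniform_limit[OF bounded_linear_of_real lim])
  have "((\<lambda>i. of_real (1 / arclength (c i) pi) *
      (LINT \<theta>:{-pi<..<pi}|lebesgue.
         of_real (w \<theta>) * (cis (- phase (c i) m \<theta>) * of_real (speed (c i) \<theta>))))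
    \<longlongrightarrow> fourier_coeff c0 w m) F"
    unfolding fourier_coeff_eq[OF c0]
    using pos c by (intro tendsto_intros L tendsto_weighted_LINT[OF w kernel] continuous_on_fourier_kernel c0)
      (auto intro: continuous_on_fourier_kernel elim: eventually_mono)
  \<comment> \<open>The kernel form agrees with the coefficient only where the speed is continuous,
    that is, eventually along \<open>F\<close>.\<close>
  then show ?thesis
    by (rule Lim_transform_eventually) (use c in \<open>auto simp: fourier_coeff_eq elim!: eventually_mono\<close>)
qed

text \<open>The modes have modulus one, so the bound does not depend on \<open>m\<close>. The
  constants \<open>B\<close> and \<open>l\<close> stand in for the exact speed and length so that
  one bound serves all curves near the limit.\<close>

lemma norm_fourier_coeff_le:
  assumes c: "continuous_on {-pi..pi} (speed c)"
    and w: "w absolutely_integrable_on {-pi<..<pi}"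
    and B: "\<And>\<theta>. \<theta> \<in> {-pi<..<pi} \<Longrightarrow> speed c \<theta> \<le> B"
    and l: "0 < l" "l \<le> arclength c pi"
  shows "norm (fourier_coeff c w m) \<le> (LINT \<theta>:{-pi<..<pi}|lebesgue. \<bar>w \<theta>\<bar>) * B / l"
proof -
  define W where "W = (LINT \<theta>:{-pi<..<pi}|lebesgue. \<bar>w \<theta>\<bar>)"
  have W: "W \<ge> 0"
    unfolding W_def set_lebesgue_integral_def by (rule Bochner_Integration.integral_nonneg) auto
  \<comment> \<open>The parameter 0 is just some point of the interval at which the nonnegative
    speed is below \<open>B\<close>.\<close>
  have B0: "B \<ge> 0"
    using order_trans[OF speed_nonneg B[of 0]] by simp
  have wn: "(\<lambda>x. \<bar>w x\<bar>) absolutely_integrable_on {-pi<..<pi}"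
    using absolutely_integrable_norm[OF w] by (simp add: o_def)
  define f where "f \<theta> = complex_of_real (w \<theta>) * (cis (- phase c m \<theta>) * of_real (speed c \<theta>))" for \<theta>
  have f: "f absolutely_integrable_on {-pi<..<pi}"
    unfolding f_def by (rule absolutely_integrable_mult_continuous[OF w continuous_on_fourier_kernel[OF c]])
  have "norm (LINT \<theta>:{-pi<..<pi}|lebesgue. f \<theta>) \<le> (LINT \<theta>:{-pi<..<pi}|lebesgue. norm (f \<theta>))"
    using f by (rule set_integral_norm_bound)
  also have "\<dots> \<le> (LINT \<theta>:{-pi<..<pi}|lebesgue. \<bar>w \<theta>\<bar> * B)"
  proof (rule set_integral_mono)
    show "set_integrable lebesgue {-pi<..<pi} (\<lambda>\<theta>. norm (f \<theta>))"
      using absolutely_integrable_norm[OF f] by (simp add: o_def)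
    show "set_integrable lebesgue {-pi<..<pi} (\<lambda>\<theta>. \<bar>w \<theta>\<bar> * B)"
      using wn by simp
    show "norm (f \<theta>) \<le> \<bar>w \<theta>\<bar> * B" if "\<theta> \<in> {-pi<..<pi}" for \<theta>
      using B[OF that] by (auto simp: f_def norm_mult speed_def intro!: mult_left_mono)
  qed
  also have "\<dots> = W * B" by (simp add: W_def)
  finally have "norm (LINT \<theta>:{-pi<..<pi}|lebesgue. f \<theta>) \<le> W * B" .
  then have "norm (fourier_coeff c w m) \<le> W * B / arclength c pi"
    using l by (simp add: fourier_coeff_eq[OF c] f_def[symmetric] norm_mult norm_divide divide_right_mono)
  also have "\<dots> \<le> W * B / l"
    using l W B0 by (intro divide_left_mono) auto
  finally show ?thesis by (simp add: W_def)
qed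

section \<open>Uniform convergence of the Fourier solutions\<close>

lemma uniform_limit_fourier_solution:
  fixes c :: "'i \<Rightarrow> real \<Rightarrow> 'a::euclidean_space" and c0 :: "real \<Rightarrow> 'b::euclidean_space"
  assumes c: "eventually (\<lambda>i. continuous_on {-pi..pi} (speed (c i))) F"
    and c0: "continuous_on {-pi..pi} (speed c0)"
    and lim: "uniform_limit {-pi..pi} (\<lambda>i. speed (c i)) (speed c0) F"
    and pos: "arclength c0 pi > 0"
    and w: "w absolutely_integrable_on {-pi<..<pi}"
    and t: "t > 0"
  shows "uniform_limit {-pi..pi} (\<lambda>i. fourier_solution (c i) \<mu> w t) (fourier_solution c0 \<mu> w t) F"
proof -
  define L where "L = arclength c0 pi"
  define W where "W = (LINT \<theta>:{-pi<..<pi}|lebesgue. \<bar>w \<theta>\<bar>)"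
  \<comment> \<open>The decay rate belonging to a curve of length \<open>2 * L\<close>. Eventually
    all curves are shorter, so their modes decay at least this fast.\<close>
  define k where "k = (pi / L)\<^sup>2 * t"
  have k: "k > 0" using pos t by (simp add: k_def L_def)
  have lim_L: "((\<lambda>i. arclength (c i) pi) \<longlongrightarrow> L) F"
    unfolding L_def by (rule tendsto_uniform_limitI[OF uniform_limit_arclength[OF c c0 lim]]) auto
  have "bounded (speed c0 ` {-pi..pi})"
    by (intro compact_imp_bounded compact_continuous_image c0 compact_Icc)
  then obtain B where B: "\<And>\<theta>. \<theta> \<in> {-pi..pi} \<Longrightarrow> speed c0 \<theta> \<le> B"
    unfolding bounded_iff using abs_le_D1 by fastforce
  have ev_speed: "eventually (\<lambda>i. \<forall>\<theta>\<in>{-pi..pi}. dist (speed (c i) \<theta>) (speed c0 \<theta>) < 1) F"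
    using lim by (auto simp: uniform_limit_iff)
  have ev_L: "eventually (\<lambda>i. L / 2 < arclength (c i) pi) F" "eventually (\<lambda>i. arclength (c i) pi < 2 * L) F"
    using order_tendstoD(1)[OF lim_L, of "L / 2"] order_tendstoD(2)[OF lim_L, of "2 * L"] pos
    by (auto simp: L_def)
  \<comment> \<open>Eventually the speeds are at most \<open>B + 1\<close> and the lengths at least
    \<open>L / 2\<close>, which bounds the coefficients by the factor in front.\<close>
  define M where "M m = W * (B + 1) / (L / 2) * exp (- k * (of_int m)\<^sup>2)" for m :: int
  define T where "T i m \<theta> = fourier_coeff (c i) w m *
        of_real (exp (- (2 * pi / arclength (c i) pi)\<^sup>2 * (of_int m)\<^sup>2 * t)) * cis (phase (c i) m \<theta>)" for i m \<theta>
  define T0 where "T0 m \<theta> = fourier_coeff c0 w m *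
        of_real (exp (- (2 * pi / L)\<^sup>2 * (of_int m)\<^sup>2 * t)) * cis (phase c0 m \<theta>)" for m \<theta>
  have "uniform_limit {-pi..pi} (\<lambda>i \<theta>. \<Sum>\<^sub>\<infinity>m. T i m \<theta>) (\<lambda>\<theta>. \<Sum>\<^sub>\<infinity>m. T0 m \<theta>) F"
  proof (rule uniform_limit_infsum_dominated[where M = M])
    show "M summable_on UNIV"
      unfolding M_def by (intro summable_on_cmult_right summable_on_int_gaussian k)
    show "uniform_limit {-pi..pi} (\<lambda>i. T i m) (T0 m) F" for m
    proof -
      have "((\<lambda>i. fourier_coeff (c i) w m *
          complex_of_real (exp (- (2 * pi / arclength (c i) pi)\<^sup>2 * (of_int m)\<^sup>2 * t)))
        \<longlongrightarrow> fourier_coeff c0 w m * complex_of_real (exp (- (2 * pi / L)\<^sup>2 * (of_int m)\<^sup>2 * t))) F"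
        using pos unfolding L_def
        by (intro tendsto_intros tendsto_fourier_coeff[OF c c0 lim pos w] lim_L[unfolded L_def]) auto
      from tendsto_imp_uniform_limit[OF this, of "{-pi..pi}"]
      show ?thesis unfolding T_def T0_def
        by (rule uniform_lim_mult[OF _ uniform_limit_cis[OF uniform_limit_phase[OF c c0 lim pos]]])
          (auto simp: bounded_iff)
    qed
    show "eventually (\<lambda>i. \<forall>m. \<forall>\<theta>\<in>{-pi..pi}. norm (T i m \<theta>) \<le> M m) F"
      using c ev_speed ev_L
    proof eventually_elim
      case (elim i)
      have speed_le: "speed (c i) \<theta> \<le> B + 1" if "\<theta> \<in> {-pi<..<pi}" for \<theta>
      proof -
        have "\<theta> \<in> {-pi..pi}" using that by simp
        with elim(2) have "dist (speed (c i) \<theta>) (speed c0 \<theta>) < 1" by blast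
        with B[OF \<open>\<theta> \<in> {-pi..pi}\<close>] show ?thesis by (simp add: dist_real_def)
      qed
      show ?case
      proof (intro allI ballI)
        fix m \<theta>
        have coeff: "norm (fourier_coeff (c i) w m) \<le> W * (B + 1) / (L / 2)"
          unfolding W_def
          by (rule norm_fourier_coeff_le) (use elim w speed_le pos in \<open>auto simp: L_def\<close>)
        have "pi / L \<le> 2 * pi / arclength (c i) pi"
          using elim(3,4) pos by (simp add: L_def field_simps)
        then have "(pi / L)\<^sup>2 \<le> (2 * pi / arclength (c i) pi)\<^sup>2"
          using pos by (intro power_mono) (auto simp: L_def)
        then have "k * (of_int m)\<^sup>2 \<le> (2 * pi / arclength (c i) pi)\<^sup>2 * (of_int m)\<^sup>2 * t"
          using t by (simp add: k_def mult_left_mono mult_ac)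
        then have "exp (- (2 * pi / arclength (c i) pi)\<^sup>2 * (of_int m)\<^sup>2 * t) \<le> exp (- k * (of_int m)\<^sup>2)"
          by simp
        from mult_mono[OF coeff this] show "norm (T i m \<theta>) \<le> M m"
          unfolding T_def M_def norm_mult norm_of_real norm_cis abs_exp_cancel mult_1_right
          using order_trans[OF norm_ge_zero coeff] by simp
      qed
    qed
  qed
  then show ?thesis
    unfolding fourier_solution_eq[abs_def] T_def T0_def L_def
    by (rule bounded_linear.uniform_limit[OF bounded_linear_mult_right])
qed

section \<open>Speeds of the singular and the regularized curves\<close>

lemma speed_gam:
  "speed gam \<theta> = sqrt ((sin \<theta> / 2)\<^sup>2 + ((cos \<theta> + (cos \<theta>)\<^sup>2 - (sin \<theta>)\<^sup>2) / 4)\<^sup>2)"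
proof -
  have "(gam has_vector_derivative (- sin \<theta> / 2, (cos \<theta> + (cos \<theta>)\<^sup>2 - (sin \<theta>)\<^sup>2) / 4)) (at \<theta>)"
    unfolding gam_def[abs_def]
    by (intro has_vector_derivative_Pair)
      (auto intro!: derivative_eq_intros simp: has_real_derivative_iff_has_vector_derivative[symmetric]
         power2_eq_square field_simps)
  then have "vector_derivative gam (at \<theta>) = (- sin \<theta> / 2, (cos \<theta> + (cos \<theta>)\<^sup>2 - (sin \<theta>)\<^sup>2) / 4)"
    by (rule vector_derivative_at)
  then show ?thesis
    by (simp add: speed_def norm_Pair power_divide)
qed

text \<open>The first two velocity components are those of \<open>gam\<close>; the third one adds by
  Pythagoras.\<close>

lemma speed_gam_eps:
  "speed (gam_eps \<epsilon>) \<theta> = sqrt ((speed gam \<theta>)\<^sup>2 + (\<epsilon> / 2 * cos \<theta>)\<^sup>2)"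
proof -
  have "(gam_eps \<epsilon> has_vector_derivative
      (- sin \<theta> / 2, (cos \<theta> + (cos \<theta>)\<^sup>2 - (sin \<theta>)\<^sup>2) / 4, \<epsilon> / 2 * cos \<theta>)) (at \<theta>)"
    unfolding gam_eps_def[abs_def]
    by (intro has_vector_derivative_Pair)
      (auto intro!: derivative_eq_intros simp: has_real_derivative_iff_has_vector_derivative[symmetric]
         power2_eq_square field_simps)
  then have "vector_derivative (gam_eps \<epsilon>) (at \<theta>) =
      (- sin \<theta> / 2, (cos \<theta> + (cos \<theta>)\<^sup>2 - (sin \<theta>)\<^sup>2) / 4, \<epsilon> / 2 * cos \<theta>)"
    by (rule vector_derivative_at)
  then show ?thesis
    by (simp add: speed_gam) (simp add: speed_def norm_Pair power_divide)
qed

lemma continuous_on_speed_gam: "continuous_on A (speed gam)"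
  unfolding speed_gam[abs_def] by (intro continuous_intros) auto

lemma continuous_on_speed_gam_eps: "continuous_on A (speed (gam_eps \<epsilon>))"
  unfolding speed_gam_eps[abs_def] by (intro continuous_intros continuous_on_speed_gam) auto

text \<open>A continuous nonnegative integrand with integral zero vanishes identically, but the
  speed at 0 is 1/2.\<close>

lemma arclength_gam_pi_pos: "arclength gam pi > 0"
proof -
  have "0 \<le> integral {-pi..pi} (speed gam)"
    by (rule Henstock_Kurzweil_Integration.integral_nonneg)
      (simp_all add: integrable_continuous_real continuous_on_speed_gam speed_nonneg)
  moreover have "integral {-pi..pi} (speed gam) \<noteq> 0"
  proof
    assume "integral {-pi..pi} (speed gam) = 0"
    then have "\<forall>x\<in>{-pi..pi}. speed gam x = 0"
      by (subst (asm) integral_eq_0_iff) (simp_all add: continuous_on_speed_gam speed_nonneg)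
    then have "speed gam 0 = 0" by auto
    then show False by (simp add: speed_gam)
  qed
  ultimately show ?thesis by (simp add: arclength_eq_integral_speed)
qed

text \<open>For a \<ge> 0 the root of a^2 + b^2 lies between a and a + |b|, here with |b| \<le>
  \<epsilon>/2. The estimate is absolute and so survives at the parameters -pi and pi, where the
  speed of \<open>gam\<close> vanishes.\<close>

lemma uniform_limit_speed_gam_eps:
  "uniform_limit A (\<lambda>\<epsilon>. speed (gam_eps \<epsilon>)) (speed gam) (at_right 0)"
proof (rule uniform_limitI)
  fix e :: real assume e: "e > 0"
  have "eventually (\<lambda>\<epsilon>::real. \<epsilon> \<in> {0<..<e}) (at_right 0)"
    using e by (rule eventually_at_right_real)
  then show "eventually (\<lambda>\<epsilon>. \<forall>\<theta>\<in>A. dist (speed (gam_eps \<epsilon>) \<theta>) (speed gam \<theta>) < e) (at_right 0)"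
  proof eventually_elim
    case (elim \<epsilon>)
    show ?case
    proof
      fix \<theta>
      have "speed gam \<theta> \<le> speed (gam_eps \<epsilon>) \<theta>"
        unfolding speed_gam_eps by (rule real_le_rsqrt) simp
      moreover have "speed (gam_eps \<epsilon>) \<theta> \<le> speed gam \<theta> + \<bar>\<epsilon> / 2 * cos \<theta>\<bar>"
        unfolding speed_gam_eps using sqrt_sum_squares_le_sum_abs[of "speed gam \<theta>" "\<epsilon> / 2 * cos \<theta>"] speed_nonneg[of gam \<theta>] by simp
      moreover have "\<bar>\<epsilon> / 2 * cos \<theta>\<bar> \<le> \<epsilon> / 2"
        using elim by (simp add: abs_mult mult_left_le)
      ultimately show "dist (speed (gam_eps \<epsilon>) \<theta>) (speed gam \<theta>) < e"
        using elim by (simp add: dist_real_def)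
    qed
  qed
qed

section \<open>Points of the singular curve, the pull-down and the conclusion\<close>

text \<open>Solving the formula of \<open>gam\<close> for cosine and sine gives 2x - 1 and 2y/x. The
  equation of the curve puts this pair on the unit circle, and its argument is the
  parameter.\<close>

lemma curve_S_parametrized:
  assumes "p \<in> curve_S - {(0, 0)}"
  obtains \<theta> where "\<theta> \<in> {-pi<..<pi}" "p = gam \<theta>"
proof -
  obtain x y where p: "p = (x, y)" by fastforce
  have eq: "y\<^sup>2 = x^3 - x^4" and "x \<noteq> 0 \<or> y \<noteq> 0"
    using assms by (auto simp: p curve_S_def)
  then have x: "x \<noteq> 0" by auto
  have "(y / x)\<^sup>2 = x - x\<^sup>2"
    using eq x by (simp add: power_divide field_simps power2_eq_square power3_eq_cube power4_eq_xxxx)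
  moreover have "(2 * y / x)\<^sup>2 = 4 * (y / x)\<^sup>2"
    by (simp add: power_divide)
  moreover have "(2 * x - 1)\<^sup>2 + 4 * (x - x\<^sup>2) = 1"
    by (simp add: power2_eq_square algebra_simps)
  ultimately have 1: "(2 * x - 1)\<^sup>2 + (2 * y / x)\<^sup>2 = 1"
    by (simp only:)
  define z where "z = Complex (2 * x - 1) (2 * y / x)"
  have "norm z = 1" using 1 by (simp add: z_def cmod_def)
  moreover have "z \<noteq> 0" using \<open>norm z = 1\<close> by auto
  ultimately have "cis (Arg z) = z"
    using cis_Arg[of z] by (simp add: sgn_eq)
  then have cs: "cos (Arg z) = 2 * x - 1" "sin (Arg z) = 2 * y / x"
    by (auto simp: z_def complex_eq_iff)
  \<comment> \<open>Argument pi means 2x - 1 = -1, that is x = 0, the excluded origin.\<close>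
  have "Arg z \<noteq> pi" using cs(1) x by auto
  then have "Arg z \<in> {-pi<..<pi}"
    using Arg_bounded[of z] by auto
  moreover have "p = gam (Arg z)"
    using x by (simp add: p gam_def cs)
  ultimately show ?thesis using that by blast
qed

text \<open>Along \<open>gam\<close> the quotient y/x is sin \<theta> / 2, so \<epsilon> y/x is the
  third coordinate of \<open>gam_eps\<close>. The division is legitimate since cos \<theta> = -1
  occurs only at odd multiples of pi.\<close>

lemma pull_down_gam:
  assumes "\<theta> \<in> {-pi<..<pi}"
  shows "pull_down \<epsilon> v t (gam \<theta>) = v t (gam_eps \<epsilon> \<theta>)"
proof -
  have "1 + cos \<theta> \<noteq> 0"
  proof
    assume "1 + cos \<theta> = 0"
    then have "cos \<bar>\<theta>\<bar> = cos pi" by simp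
    then have "\<bar>\<theta>\<bar> = pi" using assms by (intro cos_inj_pi[OF _ _ _ _ \<open>cos \<bar>\<theta>\<bar> = cos pi\<close>]) auto
    then show False using assms by auto
  qed
  then have "(1 / 4 * (1 + cos \<theta>) * sin \<theta>) / (1 / 2 * (1 + cos \<theta>)) = sin \<theta> / 2"
    by (simp add: divide_simps)
  then show ?thesis
    by (simp only: pull_down_def gam_def gam_eps_def case_prod_conv) simp
qed

theorem theorem1:
  fixes \<mu> :: real
    and u\<^sub>0 :: "real \<times> real \<Rightarrow> real"
    and u :: "real \<Rightarrow> real \<times> real \<Rightarrow> real"
    and v :: "real \<Rightarrow> real \<Rightarrow> real \<times> real \<times> real \<Rightarrow> real"
    and t :: real
  assumes "(u\<^sub>0 \<circ> gam) absolutely_integrable_on {-pi<..<pi}"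
    and "is_reference_solution \<mu> u\<^sub>0 u"
    and "\<And>\<epsilon>. \<epsilon> > 0 \<Longrightarrow> is_regularized_solution \<epsilon> \<mu> u\<^sub>0 (v \<epsilon>)"
    and "t > 0"
  shows "uniform_limit (curve_S - {(0, 0)}) (\<lambda>\<epsilon>. pull_down \<epsilon> (v \<epsilon>) t) (u t) (at_right 0)"
proof (rule uniform_limitI)
  fix e :: real assume e: "e > 0"
  have "uniform_limit {-pi..pi} (\<lambda>\<epsilon>. fourier_solution (gam_eps \<epsilon>) \<mu> (u\<^sub>0 \<circ> gam) t)
      (fourier_solution gam \<mu> (u\<^sub>0 \<circ> gam) t) (at_right 0)"
    by (rule uniform_limit_fourier_solution[OF _ continuous_on_speed_gam
          uniform_limit_speed_gam_eps arclength_gam_pi_pos assms(1,4)])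
      (simp add: continuous_on_speed_gam_eps)
  then have "eventually (\<lambda>\<epsilon>. \<forall>\<theta>\<in>{-pi..pi}. dist (fourier_solution (gam_eps \<epsilon>) \<mu> (u\<^sub>0 \<circ> gam) t \<theta>)
      (fourier_solution gam \<mu> (u\<^sub>0 \<circ> gam) t \<theta>) < e) (at_right 0)"
    using e by (simp add: uniform_limit_iff)
  then show "eventually (\<lambda>\<epsilon>. \<forall>p\<in>curve_S - {(0, 0)}. dist (pull_down \<epsilon> (v \<epsilon>) t p) (u t p) < e) (at_right 0)"
    \<comment> \<open>Supplies \<epsilon> > 0, under which \<open>v \<epsilon>\<close> is known to
      be the regularized solution.\<close>
    using eventually_at_right_less[of 0]
  proof eventually_elim
    case (elim \<epsilon>)
    show ?case
    proof
      fix p assume "p \<in> curve_S - {(0, 0)}"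
      then obtain \<theta> where \<theta>: "\<theta> \<in> {-pi<..<pi}" "p = gam \<theta>"
        by (rule curve_S_parametrized)
      have u: "complex_of_real (u t p) = fourier_solution gam \<mu> (u\<^sub>0 \<circ> gam) t \<theta>"
        using assms(2,4) \<theta> unfolding is_reference_solution_def by blast
      have v: "complex_of_real (pull_down \<epsilon> (v \<epsilon>) t p) = fourier_solution (gam_eps \<epsilon>) \<mu> (u\<^sub>0 \<circ> gam) t \<theta>"
        using assms(3)[OF elim(2)] assms(4) \<theta>
        by (simp add: pull_down_gam is_regularized_solution_def)
      \<comment> \<open>The series are complex-valued; the embedding of the reals is isometric, so
        the estimate carries over to the real solutions.\<close>
      have "dist (complex_of_real (pull_down \<epsilon> (v \<epsilon>) t p)) (complex_of_real (u t p)) < e"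
        unfolding u v using elim(1) \<theta>(1) by auto
      then show "dist (pull_down \<epsilon> (v \<epsilon>) t p) (u t p) < e"
        by simp
    qed
  qed
qed

end
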